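(* Let $\lambda$ be a regular cardinal with $\aleph_1<\lambda<2^{\aleph_0}$, let $\kappa<2^{\aleph_0}$, and let $d_i$ ($i<\kappa$) be metrics on $\lambda$. Then there is an ultrametric $d$ on $\lambda$ such that for no $i<\kappa$ and no $K\ge1$ is there an injection $f:\lambda\to\lambda$ with $d(x,y)/K\le d_i(f(x),f(y))\le K d(x,y)$ for all $x,y<\lambda$. In particular, there is no single metric space of cardinality $\lambda$ into which every ultrametric space of cardinality $\lambda$ is bi-Lipschitz embedded (and hence none into which every such space is almost isometrically embedded).
   Context: An ultrametric is a metric $d$ satisfying $d(x,z)\le\max\{d(x,y),d(y,z)\}$. A bi-Lipschitz embedding is an injection $f$ with $d(x,y)/K\le d'(f(x),f(y))\le Kd(x,y)$ for some constant $K\ge1$. $X$ is almost isometrically embedded in $Y$ if for every $\lambda>1$ there is an injection $f:X\to Y$ with $d(f(a),f(b))<\lambda d(a,b)$ and $d(a,b)<\lambda d(f(a),f(b))$ for distinct $a,b$. *)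

theory Defs
  imports Main "HOL.Real"
begin

definition metric_on :: "'a set \<Rightarrow> ('a \<Rightarrow> 'a \<Rightarrow> real) \<Rightarrow> bool" where
  "metric_on L d \<longleftrightarrow>
     (\<forall>x\<in>L. \<forall>y\<in>L. 0 \<le> d x y \<and> (d x y = 0 \<longleftrightarrow> x = y) \<and> d x y = d y x) \<and>
     (\<forall>x\<in>L. \<forall>y\<in>L. \<forall>z\<in>L. d x z \<le> d x y + d y z)"

definition ultrametric_on :: "'a set \<Rightarrow> ('a \<Rightarrow> 'a \<Rightarrow> real) \<Rightarrow> bool" where
  "ultrametric_on L d \<longleftrightarrow> metric_on L d \<and>
     (\<forall>x\<in>L. \<forall>y\<in>L. \<forall>z\<in>L. d x z \<le> max (d x y) (d y z))"

definition bilip_embeds ::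
  "'a set \<Rightarrow> ('a \<Rightarrow> 'a \<Rightarrow> real) \<Rightarrow> 'b set \<Rightarrow> ('b \<Rightarrow> 'b \<Rightarrow> real) \<Rightarrow> bool" where
  "bilip_embeds L d M e \<longleftrightarrow>
     (\<exists>K::real. K \<ge> 1 \<and> (\<exists>f. inj_on f L \<and> f ` L \<subseteq> M \<and>
        (\<forall>x\<in>L. \<forall>y\<in>L. d x y / K \<le> e (f x) (f y) \<and> e (f x) (f y) \<le> K * d x y)))"

definition almost_isom_embeds ::
  "'a set \<Rightarrow> ('a \<Rightarrow> 'a \<Rightarrow> real) \<Rightarrow> 'b set \<Rightarrow> ('b \<Rightarrow> 'b \<Rightarrow> real) \<Rightarrow> bool" where
  "almost_isom_embeds L d M e \<longleftrightarrow>
     (\<forall>l::real. l > 1 \<longrightarrow> (\<exists>f. inj_on f L \<and> f ` L \<subseteq> M \<and>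
        (\<forall>a\<in>L. \<forall>b\<in>L. a \<noteq> b \<longrightarrow> e (f a) (f b) < l * d a b \<and> d a b < l * e (f a) (f b))))"

end

theory Submission
  imports Defs "HOL-Library.Countable_Set_Type" "HOL-Analysis.Abstract_Topology_2"
begin

text \<open>
  By Shelah's club guessing, \<open>\<lambda>\<close> many increasing \<open>\<omega>\<close>-sequences in \<open>\<lambda>\<close> suffice for every club to
  contain the range of one of them. Identify \<open>\<lambda>\<close> with the tree consisting of these sequences and of
  all finite sequences, and for \<open>t \<in> (0,1)\<close> let \<open>d\<^sub>t\<close> be the ultrametric \<open>t\<^sup>n\<close>, with \<open>n\<close> the first
  place of difference. If \<open>f\<close> is a bi-Lipschitz embedding of \<open>d\<^sub>t\<close> into a metric \<open>e\<close> on \<open>\<lambda>\<close>, take a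
  guessing sequence \<open>a\<close> consisting of ordinals closed under \<open>f\<close>, under the coding of the tree, and under
  approximation of points by the range of \<open>f\<close>. Then the \<open>e\<close>-distance of \<open>y = f a\<close> from the initial
  segment below \<open>a n\<close> is \<open>t\<^sup>n\<close> up to a constant factor, so \<open>e\<close>, \<open>y\<close> and \<open>a\<close> determine \<open>t\<close>. Fewer
  than \<open>2\<^sup>\<aleph>\<^sup>0\<close> values of \<open>t\<close> arise in this way; any other \<open>t\<close> works.

  For club guessing, choose a cofinal \<open>\<omega>\<close>-sequence \<open>c \<delta>\<close> in every \<open>\<delta>\<close> of countable cofinality. The
  claim is that for some club \<open>E\<close> the sequences of floors of \<open>c \<delta> n\<close> in \<open>E\<close> guess all clubs. If not,
  then every club \<open>E\<close> comes with a club \<open>\<Phi> E\<close> that is not guessed, and iterating \<open>\<Phi>\<close> along \<open>\<aleph>\<^sub>1\<close> gives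
  decreasing clubs \<open>E\<^sub>\<xi>\<close>. At a limit \<open>\<delta>\<close> of their intersection, the floors of all \<open>c \<delta> n\<close> are
  constant from some \<open>\<zeta> < \<aleph>\<^sub>1\<close> on, so they lie in \<open>\<Phi> E\<^sub>\<zeta>\<close>: a contradiction.
\<close>

unbundle cardinal_syntax

section \<open>Cardinalities\<close>

lemma card_of_Times_ordLess_infinite:
  assumes "infinite C" "|A| <o |C|" "|B| <o |C|"
  shows "|A \<times> B| <o |C|"
proof (cases "finite (A <+> B)")
  case True
  then have "finite (A \<times> B)" by simp
  then have "|A \<times> B| <o natLeq" by (simp add: finite_iff_ordLess_natLeq)
  also have "natLeq \<le>o |C|" using assms(1) infinite_iff_natLeq_ordLeq by blast
  finally show ?thesis .
next
  case False
  then have "|A \<times> B| \<le>o |A <+> B|"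
    by (intro card_of_Times_ordLeq_infinite_Field)
      (simp_all add: card_of_Plus1 card_of_Plus2 Field_card_of card_of_card_order_on)
  also have "|A <+> B| <o |C|"
    using assms by (rule card_of_Plus_ordLess_infinite)
  finally show ?thesis .
qed

lemma card_of_lists_infinite:
  assumes "infinite A"
  shows "|lists A| =o |A|"
proof -
  have "|{l \<in> lists A. length l = n}| \<le>o |A|" for n
  proof (induction n)
    case 0
    have "{l \<in> lists A. length l = 0} = {[]}" by auto
    then show ?case
      using assms by (auto intro: card_of_singl_ordLeq)
  next
    case (Suc n)
    have "{l \<in> lists A. length l = Suc n} = (\<Union>a\<in>A. Cons a ` {l \<in> lists A. length l = n})"
      by (auto simp: length_Suc_conv image_iff lists_eq_set)
    moreover have "|\<Union>a\<in>A. Cons a ` {l \<in> lists A. length l = n}| \<le>o |A|"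
    proof (rule card_of_UNION_ordLeq_infinite[OF assms card_of_mono1[OF subset_refl]])
      show "\<forall>a\<in>A. |Cons a ` {l \<in> lists A. length l = n}| \<le>o |A|"
        using ordLeq_transitive[OF card_of_image Suc] by blast
    qed
    ultimately show ?case by simp
  qed
  then have "|\<Union>n. {l \<in> lists A. length l = n}| \<le>o |A|"
    using assms by (intro card_of_UNION_ordLeq_infinite ballI)
      (simp_all add: infinite_iff_card_of_nat)
  moreover have "(\<Union>n. {l \<in> lists A. length l = n}) = lists A" by auto
  moreover have "|A| \<le>o |lists A|"
    using lepoll_lists[of A] by (simp add: lepoll_def card_of_ordLeq)
  ultimately show ?thesis by (simp add: ordIso_iff_ordLeq)
qed

section \<open>Well-orders\<close>

context wo_rel
begin

abbreviation below :: "'a \<Rightarrow> 'a \<Rightarrow> bool" (infix "\<sqsubseteq>" 50) where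
  "x \<sqsubseteq> y \<equiv> (x, y) \<in> r"

abbreviation strictly_below :: "'a \<Rightarrow> 'a \<Rightarrow> bool" (infix "\<sqsubset>" 50) where
  "x \<sqsubset> y \<equiv> x \<noteq> y \<and> (x, y) \<in> r"

lemma below_trans: "x \<sqsubseteq> y \<Longrightarrow> y \<sqsubseteq> z \<Longrightarrow> x \<sqsubseteq> z"
  using TRANS by (meson transD)

lemma below_antisym: "x \<sqsubseteq> y \<Longrightarrow> y \<sqsubseteq> x \<Longrightarrow> x = y"
  using ANTISYM by (meson antisymD)

lemma below_strict_trans: "x \<sqsubseteq> y \<Longrightarrow> y \<sqsubset> z \<Longrightarrow> x \<sqsubset> z"
  by (metis below_antisym below_trans)

lemma strict_below_trans: "x \<sqsubset> y \<Longrightarrow> y \<sqsubseteq> z \<Longrightarrow> x \<sqsubset> z"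
  by (metis below_antisym below_trans)

lemma ex_minimizer:
  assumes "f ` A \<subseteq> Field r" "A \<noteq> {}"
  shows "\<exists>x\<in>A. \<forall>y\<in>A. f x \<sqsubseteq> f y"
proof -
  obtain x where "x \<in> A" "minim (f ` A) = f x"
    using minim_in[OF assms(1)] assms(2) by auto
  then show ?thesis using minim_least[OF assms(1)] by auto
qed

lemma strictly_below_sequence:
  assumes "\<And>n. s n \<sqsubset> s (Suc n)" "m < n"
  shows "s m \<sqsubset> s n"
  using assms(2)
proof (induction rule: less_Suc_induct)
  case (1 i)
  show ?case by (rule assms(1))
next
  case (2 i j k)
  then show ?case using strict_below_trans by blast
qed

lemma regularCard_AboveS_nonempty:
  assumes "Cinfinite r" "regularCard r" "S \<subseteq> Field r" "|S| <o r"
  shows "AboveS S \<noteq> {}"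
proof -
  have "\<not> cofinal S r"
    using assms(2-4) not_ordLess_ordIso unfolding regularCard_def by blast
  then obtain x where x: "x \<in> Field r" "\<And>y. y \<in> S \<Longrightarrow> y \<sqsubseteq> x"
    using assms(3) in_notinI unfolding cofinal_def by (metis subsetD)
  obtain z where "z \<in> Field r" "x \<sqsubset> z"
    using infinite_Card_order_limit[of r x] assms(1) x(1) by (auto simp: cinfinite_def)
  then have "z \<in> AboveS S"
    using below_strict_trans[OF x(2)] by (auto simp: AboveS_def)
  then show ?thesis by blast
qed

lemma Above_subset_Field: "Above S \<subseteq> Field r"
  by (auto simp: Above_def)

lemma supr_in_Above: "Above S \<noteq> {} \<Longrightarrow> supr S \<in> Above S"
  unfolding supr_def by (rule minim_in[OF Above_subset_Field])

lemma supr_in_Field: "Above S \<noteq> {} \<Longrightarrow> supr S \<in> Field r"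
  using supr_in_Above Above_subset_Field by blast

lemma below_supr: "Above S \<noteq> {} \<Longrightarrow> x \<in> S \<Longrightarrow> x \<sqsubseteq> supr S"
  using supr_in_Above by (auto simp: Above_def)

lemma supr_below: "u \<in> Above S \<Longrightarrow> supr S \<sqsubseteq> u"
  unfolding supr_def by (rule minim_least[OF Above_subset_Field])

lemma strictly_below_suprD:
  assumes "Above S \<noteq> {}" "x \<sqsubset> supr S"
  shows "\<exists>y\<in>S. x \<sqsubset> y"
proof (rule ccontr)
  assume none_above: "\<not> (\<exists>y\<in>S. x \<sqsubset> y)"
  have x: "x \<in> Field r" using assms(2) by (auto simp: Field_def)
  have "y \<sqsubseteq> x" if "y \<in> S" for y
  proof -
    have "y \<in> Field r" using below_supr[OF assms(1) that] by (auto simp: Field_def)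
    then show ?thesis using none_above that x in_notinI[of x y] by metis
  qed
  then have "supr S \<sqsubseteq> x" using x by (intro supr_below) (simp add: Above_def)
  then show False using assms(2) below_antisym by blast
qed

end

section \<open>Closed unbounded sets\<close>

locale uncountable_regular_cardinal =
  fixes r :: "'a rel"
  assumes Card_order: "Card_order r"
    and regular: "regularCard r"
    and uncountable: "natLeq <o r"

sublocale uncountable_regular_cardinal \<subseteq> wo_rel r
  using Card_order by (simp add: card_order_on_def wo_rel_def)

lemma uncountable_regular_cardinal_cardSuc:
  assumes "Cinfinite q"
  shows "uncountable_regular_cardinal (cardSuc q)"
proof
  show "Card_order (cardSuc q)" "regularCard (cardSuc q)"
    using assms by (simp_all add: cardSuc_Card_order regularCard_cardSuc)
  have "natLeq \<le>o q" using assms by (rule natLeq_ordLeq_cinfinite)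
  also have "q <o cardSuc q" using assms by (simp add: cardSuc_greater)
  finally show "natLeq <o cardSuc q" .
qed

context uncountable_regular_cardinal
begin

abbreviation small :: "'b set \<Rightarrow> bool" where
  "small A \<equiv> |A| <o r"

lemma Cinfinite: "Cinfinite r"
  using cinfinite_mono[OF ordLess_imp_ordLeq[OF uncountable] natLeq_cinfinite] Card_order ..

lemma infinite_Field: "infinite (Field r)"
  using Cinfinite by (simp add: cinfinite_def)

lemma small_countable: "countable A \<Longrightarrow> small A"
  using uncountable by (meson countable_card_le_natLeq ordLeq_ordLess_trans)

lemma small_image: "small A \<Longrightarrow> small (f ` A)"
  using card_of_image ordLeq_ordLess_trans by blast

lemma small_UN: "small I \<Longrightarrow> (\<And>i. i \<in> I \<Longrightarrow> small (A i)) \<Longrightarrow> small (\<Union>i\<in>I. A i)"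
  using card_of_UNION_ordLess_infinite_Field_regularCard[OF regular Cinfinite] by blast

lemma small_Un: "small A \<Longrightarrow> small B \<Longrightarrow> small (A \<union> B)"
  using card_of_Un_ordLess_infinite_Field[OF infinite_Field Card_order] by blast

lemma small_lists: "small A \<Longrightarrow> small (lists A)"
  using card_of_lists_infinite small_countable countable_lists countable_finite ordIso_ordLess_trans
  by metis

lemma small_under:
  assumes "x \<in> Field r"
  shows "small (under x)"
proof -
  have "under x = underS x \<union> {x}"
    using REFL assms by (rule Refl_under_underS)
  then show ?thesis
    using small_Un[OF card_of_underS[OF Card_order assms] small_countable[of "{x}"]] by simp
qed

lemma small_AboveS: "S \<subseteq> Field r \<Longrightarrow> small S \<Longrightarrow> AboveS S \<noteq> {}"
  using regularCard_AboveS_nonempty[OF Cinfinite regular] .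

lemma small_Above: "S \<subseteq> Field r \<Longrightarrow> small S \<Longrightarrow> Above S \<noteq> {}"
  using small_AboveS[of S] by (auto simp: Above_def AboveS_def)

text \<open>The empty set \<open>S\<close> is allowed, so every club contains the least element of the field and every
  element of the field has a floor in it.\<close>

definition club :: "'a set \<Rightarrow> bool" where
  "club E \<longleftrightarrow> E \<subseteq> Field r \<and> cofinal E r \<and> (\<forall>S\<subseteq>E. Above S \<noteq> {} \<longrightarrow> supr S \<in> E)"

lemma club_subset: "club E \<Longrightarrow> E \<subseteq> Field r"
  by (simp add: club_def)

lemma club_unbounded: "club E \<Longrightarrow> x \<in> Field r \<Longrightarrow> \<exists>y\<in>E. x \<sqsubset> y"
  by (simp add: club_def cofinal_def)

lemma club_supr: "club E \<Longrightarrow> S \<subseteq> E \<Longrightarrow> Above S \<noteq> {} \<Longrightarrow> supr S \<in> E"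
  by (simp add: club_def)

definition floor_in :: "'a set \<Rightarrow> 'a \<Rightarrow> 'a" where
  "floor_in E x = supr {y \<in> E. y \<sqsubseteq> x}"

lemma in_Above_floor: "x \<in> Field r \<Longrightarrow> x \<in> Above {y \<in> E. y \<sqsubseteq> x}"
  by (simp add: Above_def)

lemma floor_in_mem: "club E \<Longrightarrow> x \<in> Field r \<Longrightarrow> floor_in E x \<in> E"
  unfolding floor_in_def using in_Above_floor by (intro club_supr) auto

lemma floor_in_below: "x \<in> Field r \<Longrightarrow> floor_in E x \<sqsubseteq> x"
  unfolding floor_in_def by (intro supr_below in_Above_floor)

lemma below_floor_in:
  assumes "y \<in> E" "y \<sqsubseteq> x"
  shows "y \<sqsubseteq> floor_in E x"
proof -
  have "x \<in> Field r" using assms(2) by (auto simp: Field_def)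
  then have "Above {y \<in> E. y \<sqsubseteq> x} \<noteq> {}" using in_Above_floor by blast
  then show ?thesis unfolding floor_in_def using assms by (intro below_supr) simp_all
qed

lemma floor_in_mono:
  assumes "club E" "E \<subseteq> E'" "x \<in> Field r"
  shows "floor_in E x \<sqsubseteq> floor_in E' x"
  using assms floor_in_mem floor_in_below by (intro below_floor_in) auto

definition closure_points :: "('a \<Rightarrow> 'a set) \<Rightarrow> 'a set" where
  "closure_points S = {x \<in> Field r. \<forall>y\<in>underS x. S y \<subseteq> underS x}"

lemma closure_pointsD: "x \<in> closure_points S \<Longrightarrow> y \<sqsubset> x \<Longrightarrow> z \<in> S y \<Longrightarrow> z \<sqsubset> x"
  by (auto simp: closure_points_def underS_def)

lemma supr_in_closure_points:
  assumes "Above A \<noteq> {}" "\<And>x y. x \<in> A \<Longrightarrow> y \<sqsubset> x \<Longrightarrow> \<exists>z\<in>A. S y \<subseteq> underS z"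
  shows "supr A \<in> closure_points S"
proof -
  have "S y \<subseteq> underS (supr A)" if y: "y \<sqsubset> supr A" for y
  proof -
    obtain x where "x \<in> A" "y \<sqsubset> x" using strictly_below_suprD[OF assms(1) y] by blast
    then obtain z where "z \<in> A" "S y \<subseteq> underS z" using assms(2) by blast
    moreover have "underS z \<subseteq> underS (supr A)"
      using below_supr[OF assms(1) \<open>z \<in> A\<close>] by (intro underS_incr[OF TRANS ANTISYM])
    ultimately show ?thesis by blast
  qed
  then show ?thesis using supr_in_Field[OF assms(1)] by (simp add: closure_points_def underS_def)
qed

lemma ex_closure_point_above:
  assumes S: "\<And>x. x \<in> Field r \<Longrightarrow> S x \<subseteq> Field r" "\<And>x. x \<in> Field r \<Longrightarrow> small (S x)"
    and x: "x \<in> Field r"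
  shows "\<exists>y\<in>closure_points S. x \<sqsubset> y"
proof -
  define T where "T u = insert u (\<Union>y\<in>under u. S y)" for u
  define s where "s n = ((\<lambda>u. suc (T u)) ^^ n) x" for n
  have in_Field: "y \<in> Field r" if "y \<in> under u" for y u
    using that under_Field[of r u] by blast
  have T_Field: "T u \<subseteq> Field r" if "u \<in> Field r" for u
    using that S(1) in_Field by (auto simp: T_def)
  have T_AboveS: "AboveS (T u) \<noteq> {}" if u: "u \<in> Field r" for u
  proof (rule small_AboveS[OF T_Field[OF u]])
    have "small (\<Union>y\<in>under u. S y)"
      using small_under[OF u] S(2)[OF in_Field] by (rule small_UN)
    then show "small (T u)"
      using small_Un[OF small_countable[of "{u}"]] by (simp add: T_def)
  qed
  have s_Field: "s n \<in> Field r" for n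
    by (induction n) (use x T_Field T_AboveS suc_inField in \<open>auto simp: s_def\<close>)
  have s_step: "y \<sqsubset> s (Suc n)" if "y \<in> T (s n)" for y n
    using suc_greater[OF T_Field[OF s_Field] T_AboveS[OF s_Field] that] by (auto simp: s_def)
  have bounded: "Above (range s) \<noteq> {}"
    using s_Field by (intro small_Above small_countable) auto
  have "supr (range s) \<in> closure_points S"
  proof (rule supr_in_closure_points[OF bounded])
    fix u y assume "u \<in> range s" "y \<sqsubset> u"
    then obtain n where "y \<in> under (s n)" by (auto simp: under_def)
    then have "S y \<subseteq> T (s n)" by (auto simp: T_def)
    then have "S y \<subseteq> underS (s (Suc n))" using s_step by (auto simp: underS_def)
    then show "\<exists>z\<in>range s. S y \<subseteq> underS z" by blast
  qed
  moreover have "x \<sqsubset> s 1" using s_step[of x 0] by (simp add: s_def T_def)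
  then have "x \<sqsubset> supr (range s)"
    using below_supr[OF bounded] strict_below_trans by blast
  ultimately show ?thesis by blast
qed

lemma club_closure_points:
  assumes "\<And>x. x \<in> Field r \<Longrightarrow> S x \<subseteq> Field r" "\<And>x. x \<in> Field r \<Longrightarrow> small (S x)"
  shows "club (closure_points S)"
proof -
  have "supr A \<in> closure_points S" if A: "A \<subseteq> closure_points S" "Above A \<noteq> {}" for A
  proof (rule supr_in_closure_points[OF A(2)])
    fix x y assume "x \<in> A" "y \<sqsubset> x"
    then show "\<exists>z\<in>A. S y \<subseteq> underS z"
      using A(1) by (auto simp: closure_points_def underS_def)
  qed
  moreover have "cofinal (closure_points S) r"
    using ex_closure_point_above[OF assms] by (simp add: cofinal_def)
  ultimately show ?thesis
    by (auto simp: club_def closure_points_def)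
qed

lemma club_INT:
  assumes "small J" and club: "\<And>j. j \<in> J \<Longrightarrow> club (E j)"
  shows "club (Field r \<inter> (\<Inter>j\<in>J. E j))"
proof -
  have "\<forall>j\<in>J. \<forall>x\<in>Field r. \<exists>y. y \<in> E j \<and> x \<sqsubset> y"
    using club club_unbounded by blast
  then obtain succ where succ: "\<And>j x. j \<in> J \<Longrightarrow> x \<in> Field r \<Longrightarrow> succ j x \<in> E j \<and> x \<sqsubset> succ j x"
    by metis
  let ?C = "closure_points (\<lambda>x. (\<lambda>j. succ j x) ` J)"
  have "x \<in> E j" if x: "x \<in> ?C" and j: "j \<in> J" for x j
  proof -
    have x_Field: "x \<in> Field r" using x by (simp add: closure_points_def)
    let ?y = "floor_in (E j) x"
    have y: "?y \<in> E j" "?y \<sqsubseteq> x"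
      using floor_in_mem[OF club[OF j] x_Field] floor_in_below[OF x_Field] .
    then have above: "succ j ?y \<in> E j" "?y \<sqsubset> succ j ?y"
      using succ[OF j] club_subset[OF club[OF j]] by blast+
    have "?y = x"
    proof (rule ccontr)
      assume "?y \<noteq> x"
      then have "succ j ?y \<sqsubset> x" using closure_pointsD[OF x] y(2) j by blast
      then have "succ j ?y \<sqsubseteq> ?y" using above(1) by (intro below_floor_in) simp_all
      then show False using above(2) below_antisym by blast
    qed
    then show ?thesis using y(1) by simp
  qed
  then have "?C \<subseteq> Field r \<inter> (\<Inter>j\<in>J. E j)" by (auto simp: closure_points_def)
  moreover have "club ?C"
  proof (rule club_closure_points)
    fix x assume "x \<in> Field r"
    then show "(\<lambda>j. succ j x) ` J \<subseteq> Field r" using succ club club_subset by blast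
    show "small ((\<lambda>j. succ j x) ` J)" using assms(1) by (rule small_image)
  qed
  ultimately have "cofinal (Field r \<inter> (\<Inter>j\<in>J. E j)) r"
    using club_unbounded unfolding cofinal_def by blast
  moreover have "supr S \<in> Field r \<inter> (\<Inter>j\<in>J. E j)"
    if "S \<subseteq> Field r \<inter> (\<Inter>j\<in>J. E j)" "Above S \<noteq> {}" for S
    using that supr_in_Field club_supr[OF club] by blast
  ultimately show ?thesis by (simp add: club_def)
qed

section \<open>Club guessing\<close>

definition ladder_at :: "'a \<Rightarrow> (nat \<Rightarrow> 'a) \<Rightarrow> bool" where
  "ladder_at \<delta> c \<longleftrightarrow> (\<forall>n. c n \<sqsubset> \<delta>) \<and> (\<forall>x. x \<sqsubset> \<delta> \<longrightarrow> (\<exists>n. x \<sqsubset> c n))"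

definition endless :: "(nat \<Rightarrow> 'a) \<Rightarrow> bool" where
  "endless x \<longleftrightarrow> (\<forall>m. \<exists>n. x m \<sqsubset> x n)"

definition guesses_clubs :: "('a \<Rightarrow> nat \<Rightarrow> 'a) \<Rightarrow> bool" where
  "guesses_clubs b \<longleftrightarrow>
     (\<forall>E. club E \<longrightarrow> (\<exists>\<delta>\<in>Field r. \<forall>n. b \<delta> n \<in> E \<and> b \<delta> n \<sqsubset> b \<delta> (Suc n)))"

lemma ex_increasing_if_endless:
  assumes "endless x"
  shows "\<exists>s. \<forall>n. s n \<in> range x \<and> s n \<sqsubset> s (Suc n)"
proof (rule dependent_nat_choice)
  show "\<exists>y. y \<in> range x" by blast
  show "\<exists>z. z \<in> range x \<and> y \<sqsubset> z" if "y \<in> range x" for y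
    using that assms by (auto simp: endless_def)
qed

lemma ex_ladder_in_club:
  assumes "club E"
  obtains \<delta> s where "\<delta> \<in> Field r" "ladder_at \<delta> s" "range s \<subseteq> E"
proof -
  have "\<exists>s. \<forall>n. s n \<in> E \<and> s n \<sqsubset> s (Suc n)"
  proof (rule dependent_nat_choice)
    show "\<exists>x. x \<in> E"
      using infinite_Field infinite_imp_nonempty club_unbounded[OF assms] by blast
    show "\<exists>y. y \<in> E \<and> x \<sqsubset> y" if "x \<in> E" for x
      using that club_subset[OF assms] club_unbounded[OF assms] by blast
  qed
  then obtain s where s: "\<And>n. s n \<in> E" "\<And>n. s n \<sqsubset> s (Suc n)" by blast
  have bounded: "Above (range s) \<noteq> {}"
    using s(1) club_subset[OF assms] by (intro small_Above small_countable) auto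
  have "s n \<sqsubset> supr (range s)" for n
    using s(2) below_supr[OF bounded rangeI] by (rule strict_below_trans)
  moreover have "\<exists>n. x \<sqsubset> s n" if "x \<sqsubset> supr (range s)" for x
    using strictly_below_suprD[OF bounded that] by blast
  ultimately have "ladder_at (supr (range s)) s"
    by (simp add: ladder_at_def)
  then show thesis
    using that[OF supr_in_Field[OF bounded]] s(1) by blast
qed

lemma ladder_Field: "ladder_at \<delta> c \<Longrightarrow> c n \<in> Field r"
  by (auto simp: ladder_at_def Field_def)

lemma endless_floor_ladder:
  assumes E: "club E" and s: "ladder_at \<delta> s" "range s \<subseteq> E" and c: "ladder_at \<delta> c"
  shows "endless (\<lambda>n. floor_in E (c n))"
  unfolding endless_def
proof
  fix m
  have "c m \<sqsubset> \<delta>" using c by (simp add: ladder_at_def)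
  with floor_in_below[OF ladder_Field[OF c]] have "floor_in E (c m) \<sqsubset> \<delta>"
    by (rule below_strict_trans)
  then obtain k where k: "floor_in E (c m) \<sqsubset> s k"
    using s(1) unfolding ladder_at_def by blast
  have "s k \<sqsubset> \<delta>" using s(1) unfolding ladder_at_def by blast
  then obtain n where "s k \<sqsubset> c n" using c unfolding ladder_at_def by blast
  then have "s k \<sqsubseteq> floor_in E (c n)" using s(2) by (intro below_floor_in) auto
  with k have "floor_in E (c m) \<sqsubset> floor_in E (c n)" by (rule strict_below_trans)
  then show "\<exists>n. floor_in E (c m) \<sqsubset> floor_in E (c n)" by blast
qed

lemma ex_decreasing_clubs:
  assumes w: "Well_order w" "small (Field w)" and \<Phi>: "\<And>E. club (\<Phi> E)"
  obtains E where "\<And>\<xi>. club (E \<xi>)"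
    "\<And>\<eta> \<xi>. \<eta> \<in> Order_Relation.underS w \<xi> \<Longrightarrow> E \<xi> \<subseteq> E \<eta> \<inter> \<Phi> (E \<eta>)"
proof -
  interpret w: wo_rel w using w(1) by (simp add: wo_rel_def)
  define E where
    "E = wfrec (w - Id) (\<lambda>f \<xi>. Field r \<inter> (\<Inter>\<eta>\<in>w.underS \<xi>. \<Phi> (f \<eta>)))"
  have E: "E \<xi> = Field r \<inter> (\<Inter>\<eta>\<in>w.underS \<xi>. \<Phi> (E \<eta>))" for \<xi>
    unfolding E_def by (subst wfrec[OF w.WF]) (auto simp: cut_apply underS_def)
  have "club (E \<xi>)" for \<xi>
  proof -
    have "small (w.underS \<xi>)"
      using card_of_mono1[OF subsetI[OF underS_Field]] w(2) by (rule ordLeq_ordLess_trans)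
    then show ?thesis unfolding E[of \<xi>] using \<Phi> by (rule club_INT)
  qed
  moreover have "E \<xi> \<subseteq> E \<eta> \<inter> \<Phi> (E \<eta>)" if "\<eta> \<in> w.underS \<xi>" for \<eta> \<xi>
  proof -
    have "w.underS \<eta> \<subseteq> w.underS \<xi>"
      using that by (intro underS_incr[OF w.TRANS w.ANTISYM]) (simp add: underS_def)
    then show ?thesis using E[of \<xi>] E[of \<eta>] that by blast
  qed
  ultimately show thesis using that by blast
qed

lemma ex_stable_floors:
  assumes w: "uncountable_regular_cardinal w"
    and E: "\<And>\<xi>. club (E \<xi>)"
      "\<And>\<eta> \<xi>. \<eta> \<in> Order_Relation.underS w \<xi> \<Longrightarrow> E \<xi> \<subseteq> E \<eta> \<inter> \<Phi> (E \<eta>)"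
    and x: "\<And>n :: nat. x n \<in> Field r"
  shows "\<exists>\<zeta>\<in>Field w. \<forall>n. floor_in (E \<zeta>) (x n) \<in> \<Phi> (E \<zeta>)"
proof -
  interpret w: uncountable_regular_cardinal w by (rule w)
  have "\<exists>\<xi>\<in>Field w. \<forall>\<eta>\<in>Field w. floor_in (E \<xi>) (x n) \<sqsubseteq> floor_in (E \<eta>) (x n)" for n
    using floor_in_mem[OF E(1) x] club_subset[OF E(1)] w.infinite_Field
    by (intro ex_minimizer) auto
  then obtain \<xi> where \<xi>: "\<And>n. \<xi> n \<in> Field w"
    "\<And>n \<eta>. \<eta> \<in> Field w \<Longrightarrow> floor_in (E (\<xi> n)) (x n) \<sqsubseteq> floor_in (E \<eta>) (x n)"
    by metis
  have "w.AboveS (range \<xi>) \<noteq> {}"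
    using \<xi>(1) by (intro w.small_AboveS w.small_countable) auto
  then obtain \<zeta> where \<zeta>: "\<zeta> \<in> Field w" "\<And>n. \<xi> n \<in> w.underS \<zeta>"
    by (auto simp: AboveS_def underS_def)
  obtain \<zeta>' where \<zeta>': "\<zeta>' \<in> Field w" "\<zeta> \<in> w.underS \<zeta>'"
    using infinite_Card_order_limit[OF w.Card_order w.infinite_Field \<zeta>(1)]
    by (auto simp: underS_def)
  have "floor_in (E \<zeta>) (x n) = floor_in (E \<zeta>') (x n)" for n
  proof (rule below_antisym)
    have "floor_in (E \<zeta>) (x n) \<sqsubseteq> floor_in (E (\<xi> n)) (x n)"
      using E(2)[OF \<zeta>(2)] by (intro floor_in_mono E(1) x) blast
    then show "floor_in (E \<zeta>) (x n) \<sqsubseteq> floor_in (E \<zeta>') (x n)"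
      using \<xi>(2)[OF \<zeta>'(1)] by (rule below_trans)
    show "floor_in (E \<zeta>') (x n) \<sqsubseteq> floor_in (E \<zeta>) (x n)"
      using E(2)[OF \<zeta>'(2)] by (intro floor_in_mono E(1) x) blast
  qed
  moreover have "floor_in (E \<zeta>') (x n) \<in> \<Phi> (E \<zeta>)" for n
    using floor_in_mem[OF E(1) x] E(2)[OF \<zeta>'(2)] by blast
  ultimately have "floor_in (E \<zeta>) (x n) \<in> \<Phi> (E \<zeta>)" for n by simp
  then show ?thesis using \<zeta>(1) by blast
qed

lemma ex_floor_guessing:
  assumes w: "uncountable_regular_cardinal w" "w <o r"
    and c: "\<And>\<delta> s. ladder_at \<delta> s \<Longrightarrow> ladder_at \<delta> (c \<delta>)"
  shows "\<exists>E. \<forall>E'. club E' \<longrightarrow>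
    (\<exists>\<delta>\<in>Field r. endless (\<lambda>n. floor_in E (c \<delta> n)) \<and> (\<forall>n. floor_in E (c \<delta> n) \<in> E'))"
proof (rule ccontr)
  assume "\<not> ?thesis"
  then have "\<forall>E. \<exists>E'. club E' \<and> (\<forall>\<delta>\<in>Field r. endless (\<lambda>n. floor_in E (c \<delta> n)) \<longrightarrow>
      \<not> (\<forall>n. floor_in E (c \<delta> n) \<in> E'))"
    by blast
  from choice[OF this] obtain \<Phi> where \<Phi>: "\<And>E. club (\<Phi> E)"
    "\<And>E. \<forall>\<delta>\<in>Field r. endless (\<lambda>n. floor_in E (c \<delta> n)) \<longrightarrow>
      \<not> (\<forall>n. floor_in E (c \<delta> n) \<in> \<Phi> E)"
    by auto
  interpret w: uncountable_regular_cardinal w by (rule w(1))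
  have small_w: "small (Field w)"
    using card_of_Field_ordIso[OF w.Card_order] w(2) by (rule ordIso_ordLess_trans)
  obtain E where E: "\<And>\<xi>. club (E \<xi>)" "\<And>\<eta> \<xi>. \<eta> \<in> w.underS \<xi> \<Longrightarrow> E \<xi> \<subseteq> E \<eta> \<inter> \<Phi> (E \<eta>)"
    by (rule ex_decreasing_clubs[OF w.WELL small_w \<Phi>(1)]) (rule that)
  have "club (Field r \<inter> (\<Inter>\<xi>\<in>Field w. E \<xi>))"
    using small_w E(1) by (rule club_INT)
  then obtain \<delta> s where \<delta>: "\<delta> \<in> Field r" and s: "ladder_at \<delta> s"
    "range s \<subseteq> Field r \<inter> (\<Inter>\<xi>\<in>Field w. E \<xi>)"
    by (rule ex_ladder_in_club)
  obtain \<zeta> where \<zeta>: "\<zeta> \<in> Field w" "\<And>n. floor_in (E \<zeta>) (c \<delta> n) \<in> \<Phi> (E \<zeta>)"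
    using ex_stable_floors[of w E \<Phi> "c \<delta>"] w(1) E ladder_Field[OF c[OF s(1)]] by blast
  have "range s \<subseteq> E \<zeta>" using s(2) \<zeta>(1) by blast
  then have "endless (\<lambda>n. floor_in (E \<zeta>) (c \<delta> n))"
    by (intro endless_floor_ladder[OF E(1) s(1) _ c[OF s(1)]])
  then show False using \<Phi>(2)[of "E \<zeta>"] \<delta> \<zeta>(2) by metis
qed

lemma ex_guesses_clubs:
  assumes "uncountable_regular_cardinal w" "w <o r"
  shows "\<exists>b. guesses_clubs b"
proof -
  define c where "c \<delta> = (SOME s. ladder_at \<delta> s)" for \<delta>
  have "ladder_at \<delta> (c \<delta>)" if "ladder_at \<delta> s" for \<delta> s
    unfolding c_def using someI[of "ladder_at \<delta>" s] that by simp
  then obtain E where E: "\<And>E'. club E' \<Longrightarrow>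
      \<exists>\<delta>\<in>Field r. endless (\<lambda>n. floor_in E (c \<delta> n)) \<and> (\<forall>n. floor_in E (c \<delta> n) \<in> E')"
    using ex_floor_guessing[OF assms, of c] by blast
  define b where
    "b \<delta> = (SOME s. \<forall>n. s n \<in> range (\<lambda>n. floor_in E (c \<delta> n)) \<and> s n \<sqsubset> s (Suc n))" for \<delta>
  have b: "\<forall>n. b \<delta> n \<in> range (\<lambda>n. floor_in E (c \<delta> n)) \<and> b \<delta> n \<sqsubset> b \<delta> (Suc n)"
    if "endless (\<lambda>n. floor_in E (c \<delta> n))" for \<delta>
    unfolding b_def using ex_increasing_if_endless[OF that] by (rule someI_ex)
  have "\<exists>\<delta>\<in>Field r. \<forall>n. b \<delta> n \<in> E' \<and> b \<delta> n \<sqsubset> b \<delta> (Suc n)" if E': "club E'" for E'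
  proof -
    obtain \<delta> where \<delta>: "\<delta> \<in> Field r" "endless (\<lambda>n. floor_in E (c \<delta> n))"
      "range (\<lambda>n. floor_in E (c \<delta> n)) \<subseteq> E'"
      using E[OF E'] by blast
    then show ?thesis using b[OF \<delta>(2)] by blast
  qed
  then show ?thesis unfolding guesses_clubs_def by blast
qed

end

section \<open>Metrics, ultrametrics and embeddings\<close>

lemma ultrametric_onI:
  assumes nonneg: "\<And>x y. x \<in> L \<Longrightarrow> y \<in> L \<Longrightarrow> 0 \<le> d x y"
    and zero: "\<And>x y. x \<in> L \<Longrightarrow> y \<in> L \<Longrightarrow> d x y = 0 \<longleftrightarrow> x = y"
    and sym: "\<And>x y. x \<in> L \<Longrightarrow> y \<in> L \<Longrightarrow> d x y = d y x"
    and ultra: "\<And>x y z. x \<in> L \<Longrightarrow> y \<in> L \<Longrightarrow> z \<in> L \<Longrightarrow> d x z \<le> max (d x y) (d y z)"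
  shows "ultrametric_on L d"
proof -
  have triangle: "d x z \<le> d x y + d y z" if "x \<in> L" "y \<in> L" "z \<in> L" for x y z
    using ultra[OF that] nonneg[OF that(1,2)] nonneg[OF that(2,3)] by linarith
  show ?thesis
    unfolding ultrametric_on_def metric_on_def
    by (intro conjI ballI nonneg zero sym ultra triangle)
qed

lemma metric_on_pullback:
  assumes "metric_on M e" "inj_on g L" "g ` L \<subseteq> M"
  shows "metric_on L (\<lambda>x y. e (g x) (g y))"
proof -
  have "g x \<in> M" if "x \<in> L" for x using assms(3) that by blast
  then show ?thesis using assms(1,2) unfolding metric_on_def by (simp add: inj_on_eq_iff)
qed

lemma ultrametric_on_pullback:
  assumes "ultrametric_on M e" "inj_on g L" "g ` L \<subseteq> M"
  shows "ultrametric_on L (\<lambda>x y. e (g x) (g y))"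
  using assms metric_on_pullback[OF _ assms(2,3)]
  unfolding ultrametric_on_def by (auto simp: image_subset_iff)

lemma bilip_embeds_pullback:
  assumes "bilip_embeds L d M e" "M \<subseteq> g ` L'"
  shows "bilip_embeds L d L' (\<lambda>x y. e (g x) (g y))"
proof -
  obtain K f where K: "K \<ge> 1" and f: "inj_on f L" "f ` L \<subseteq> M"
    "\<forall>x\<in>L. \<forall>y\<in>L. d x y / K \<le> e (f x) (f y) \<and> e (f x) (f y) \<le> K * d x y"
    using assms(1) unfolding bilip_embeds_def by blast
  let ?f = "inv_into L' g \<circ> f"
  have f_image: "f ` L \<subseteq> g ` L'" using f(2) assms(2) by (rule subset_trans)
  then have "inj_on ?f L"
    using f(1) by (intro comp_inj_on) (auto intro: inj_on_inv_into)
  moreover have "?f ` L \<subseteq> L'" using f_image by (auto simp: inv_into_into)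
  moreover have "g (?f x) = f x" if "x \<in> L" for x
    using f_image that by (simp add: f_inv_into_f image_subset_iff)
  ultimately show ?thesis
    unfolding bilip_embeds_def using K f(3) by (intro exI[of _ K] conjI exI[of _ ?f]) auto
qed

lemma metric_on_ge_if_approximable:
  assumes "metric_on M e" "z \<in> M" "y \<in> M"
    and "e z y < \<rho> \<Longrightarrow> \<exists>w\<in>M. e z w < \<rho> \<and> 2 * \<rho> \<le> e w y"
  shows "\<rho> \<le> e z y"
proof (rule ccontr)
  assume "\<not> \<rho> \<le> e z y"
  then obtain w where w: "w \<in> M" "e z w < \<rho>" "2 * \<rho> \<le> e w y" using assms(4) by auto
  have "e w y \<le> e w z + e z y" "e w z = e z w"
    using assms(1-3) w(1) unfolding metric_on_def by blast+
  then show False using w(2,3) \<open>\<not> \<rho> \<le> e z y\<close> by linarith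
qed

lemma bilip_embeds_if_almost_isom_embeds:
  assumes "almost_isom_embeds L d M e" "metric_on L d" "metric_on M e"
  shows "bilip_embeds L d M e"
proof -
  have "(1::real) < 2" by simp
  then obtain f where f: "inj_on f L" "f ` L \<subseteq> M"
    "\<forall>x\<in>L. \<forall>y\<in>L. x \<noteq> y \<longrightarrow> e (f x) (f y) < 2 * d x y \<and> d x y < 2 * e (f x) (f y)"
    using assms(1) unfolding almost_isom_embeds_def by blast
  have "d x y / 2 \<le> e (f x) (f y) \<and> e (f x) (f y) \<le> 2 * d x y" if "x \<in> L" "y \<in> L" for x y
  proof (cases "x = y")
    case True
    have "d y y = 0" "e (f y) (f y) = 0"
      using assms(2,3) f(2) that unfolding metric_on_def by blast+
    then show ?thesis using True by simp
  next
    case False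
    then show ?thesis using f(3) that by fastforce
  qed
  then show ?thesis
    unfolding bilip_embeds_def using f(1,2) by (intro exI[of _ 2] conjI exI[of _ f]) auto
qed

definition baire_dist :: "real \<Rightarrow> (nat \<Rightarrow> 'a) \<Rightarrow> (nat \<Rightarrow> 'a) \<Rightarrow> real" where
  "baire_dist t p q = (if p = q then 0 else t ^ (LEAST n. p n \<noteq> q n))"

lemma baire_dist_ge:
  assumes "0 < t" "t < 1" "p n \<noteq> q n"
  shows "t ^ n \<le> baire_dist t p q"
proof -
  have "(LEAST n. p n \<noteq> q n) \<le> n" using assms(3) by (rule Least_le)
  then have "t ^ n \<le> t ^ (LEAST n. p n \<noteq> q n)"
    using assms(1,2) by (simp add: power_decreasing)
  then show ?thesis using assms(3) by (auto simp: baire_dist_def)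
qed

lemma baire_dist_eq:
  assumes "p n \<noteq> q n" "\<And>k. k < n \<Longrightarrow> p k = q k"
  shows "baire_dist t p q = t ^ n"
proof -
  have "(LEAST n. p n \<noteq> q n) = n"
    using assms by (intro Least_equality) (auto simp: not_less[symmetric])
  then show ?thesis using assms(1) by (auto simp: baire_dist_def)
qed

lemma ultrametric_on_baire_dist:
  assumes t: "0 < t" "t < 1"
  shows "ultrametric_on UNIV (baire_dist t)"
proof (rule ultrametric_onI)
  fix p q u :: "nat \<Rightarrow> 'a"
  show nonneg: "0 \<le> baire_dist t p q" for p q :: "nat \<Rightarrow> 'a"
    using t by (simp add: baire_dist_def)
  show "baire_dist t p q = 0 \<longleftrightarrow> p = q"
    using t by (simp add: baire_dist_def)
  show "baire_dist t p q = baire_dist t q p"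
    by (simp add: baire_dist_def eq_commute)
  show "baire_dist t p u \<le> max (baire_dist t p q) (baire_dist t q u)"
  proof (cases "p = u")
    case True
    then show ?thesis using nonneg by (simp add: baire_dist_def le_max_iff_disj)
  next
    case False
    define n where "n = (LEAST n. p n \<noteq> u n)"
    have "\<exists>n. p n \<noteq> u n" using False by auto
    then have "p n \<noteq> u n" unfolding n_def by (rule LeastI_ex)
    then have "p n \<noteq> q n \<or> q n \<noteq> u n" by auto
    then have "t ^ n \<le> baire_dist t p q \<or> t ^ n \<le> baire_dist t q u"
      using baire_dist_ge[OF t] by blast
    moreover have "baire_dist t p u = t ^ n" using False by (simp add: baire_dist_def n_def)
    ultimately show ?thesis by (simp add: le_max_iff_disj)
  qed
qed

section \<open>Rates of approach\<close>

text \<open>The index 0 is excluded because in the application \<open>A 0\<close> may be empty.\<close>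

definition approaches_geometrically ::
    "('a \<Rightarrow> 'a \<Rightarrow> real) \<Rightarrow> (nat \<Rightarrow> 'a set) \<Rightarrow> 'a \<Rightarrow> real \<Rightarrow> bool" where
  "approaches_geometrically e A y t \<longleftrightarrow>
     (\<exists>C>0. \<forall>n>0. (\<exists>z\<in>A n. e z y \<le> C * t ^ n) \<and> (\<forall>z\<in>A n. t ^ n \<le> C * e z y))"

lemma le_if_powers_le_const_mult:
  fixes s t C :: real
  assumes "0 < s" "\<And>n. n > 0 \<Longrightarrow> t ^ n \<le> C * s ^ n"
  shows "t \<le> s"
proof (rule ccontr)
  assume "\<not> t \<le> s"
  then have gt: "1 < t / s" using assms(1) by simp
  then obtain n where "C < (t / s) ^ n" using real_arch_pow by blast
  also have "\<dots> \<le> (t / s) ^ Suc n" using gt by (intro power_increasing) auto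
  also have "\<dots> \<le> C"
    using assms(2)[of "Suc n"] assms(1) by (simp only: power_divide pos_divide_le_eq zero_less_power)
  finally show False by simp
qed

lemma approaches_geometrically_le:
  assumes "approaches_geometrically e A y t" "approaches_geometrically e A y s" "0 < s"
  shows "t \<le> s"
proof -
  obtain C where C: "C > 0" "\<And>n z. n > 0 \<Longrightarrow> z \<in> A n \<Longrightarrow> t ^ n \<le> C * e z y"
    using assms(1) unfolding approaches_geometrically_def by blast
  obtain C' where C': "\<And>n. n > 0 \<Longrightarrow> \<exists>z\<in>A n. e z y \<le> C' * s ^ n"
    using assms(2) unfolding approaches_geometrically_def by blast
  have "t ^ n \<le> (C * C') * s ^ n" if n: "n > 0" for n
  proof -
    obtain z where z: "z \<in> A n" "e z y \<le> C' * s ^ n" using C'[OF n] by blast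
    have "t ^ n \<le> C * e z y" using C(2)[OF n z(1)] .
    also have "\<dots> \<le> C * (C' * s ^ n)" using z(2) C(1) by (intro mult_left_mono) auto
    finally show ?thesis by (simp only: mult.assoc)
  qed
  with assms(3) show ?thesis by (rule le_if_powers_le_const_mult)
qed

lemma approaches_geometrically_unique:
  assumes "approaches_geometrically e A y t" "approaches_geometrically e A y s" "0 < t" "0 < s"
  shows "t = s"
  using approaches_geometrically_le[OF assms(1,2,4)] approaches_geometrically_le[OF assms(2,1,3)]
  by (rule antisym)

lemma ex_ratio_not_approached:
  fixes y :: "'p \<Rightarrow> 'a"
  assumes "|P| <o |UNIV :: real set|"
  shows "\<exists>t. 0 < t \<and> t < 1 \<and> (\<forall>p\<in>P. \<not> approaches_geometrically (e p) (A p) (y p) t)"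
proof (rule ccontr)
  assume "\<not> ?thesis"
  then have "\<And>t. t \<in> {0<..<1} \<Longrightarrow> \<exists>p. p \<in> P \<and> approaches_geometrically (e p) (A p) (y p) t"
    by auto
  then have "{0<..<1::real} \<lesssim> P"
    by (rule lepoll_relational_full) (auto intro: approaches_geometrically_unique)
  moreover have "(UNIV :: real set) \<approx> {0<..<1::real}"
    using open_interval_eqpoll_reals[of 0 1] eqpoll_sym by simp
  ultimately have "(UNIV :: real set) \<lesssim> P" by (metis lepoll_trans1)
  then have "|UNIV :: real set| \<le>o |P|" by (simp add: lepoll_def card_of_ordLeq)
  then show False using assms not_ordLess_ordLeq by blast
qed

section \<open>The tree of a guessing sequence\<close>

definition list_seq :: "'a list \<Rightarrow> nat \<Rightarrow> 'a option" where
  "list_seq l n = (if n < length l then Some (l ! n) else None)"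

lemma inj_list_seq: "inj list_seq"
proof (rule injI)
  fix k l :: "'a list"
  assume eq: "list_seq k = list_seq l"
  have "n < length k \<longleftrightarrow> n < length l" for n
    using fun_cong[OF eq, of n] by (simp add: list_seq_def split: if_splits)
  then have "length k = length l" by (meson less_irrefl linorder_neqE_nat)
  then show "k = l"
  proof (rule nth_equalityI)
    show "k ! n = l ! n" if "n < length k" for n
      using fun_cong[OF eq, of n] that \<open>length k = length l\<close> by (simp add: list_seq_def)
  qed
qed

context uncountable_regular_cardinal
begin

definition tree :: "('a \<Rightarrow> nat \<Rightarrow> 'a) \<Rightarrow> (nat \<Rightarrow> 'a option) set" where
  "tree b = list_seq ` lists (Field r) \<union> (\<lambda>\<delta> n. Some (b \<delta> n)) ` Field r"

lemma card_of_tree: "|tree b| =o r"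
proof -
  note Field = card_of_Field_ordIso[OF Card_order]
  have "inj_on list_seq (lists (Field r))"
    using inj_list_seq by (rule inj_on_subset) simp
  then have "|lists (Field r)| =o |list_seq ` lists (Field r)|"
    by (rule card_of_ordIsoI[OF inj_on_imp_bij_betw])
  from ordIso_symmetric[OF this] card_of_lists_infinite[OF infinite_Field]
  have "|list_seq ` lists (Field r)| =o |Field r|" by (rule ordIso_transitive)
  also note Field
  finally have lists: "|list_seq ` lists (Field r)| =o r" .
  have "|(\<lambda>\<delta> n. Some (b \<delta> n)) ` Field r| \<le>o r"
    using card_of_image Field by (rule ordLeq_ordIso_trans)
  with ordIso_imp_ordLeq[OF lists] have "|tree b| \<le>o r"
    unfolding tree_def by (rule card_of_Un_ordLeq_infinite_Field[OF infinite_Field _ _ Card_order])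
  moreover have "|list_seq ` lists (Field r)| \<le>o |tree b|"
    unfolding tree_def by (rule card_of_mono1) blast
  with ordIso_symmetric[OF lists] have "r \<le>o |tree b|" by (rule ordIso_ordLeq_trans)
  ultimately show ?thesis by (simp add: ordIso_iff_ordLeq)
qed

end

locale coded_guessing_tree = uncountable_regular_cardinal r for r :: "'a rel" +
  fixes b :: "'a \<Rightarrow> nat \<Rightarrow> 'a" and \<phi> :: "'a \<Rightarrow> nat \<Rightarrow> 'a option"
  assumes guesses_clubs: "guesses_clubs b"
    and bij: "bij_betw \<phi> (Field r) (tree b)"
begin

definition code :: "(nat \<Rightarrow> 'a option) \<Rightarrow> 'a" where
  "code p = inv_into (Field r) \<phi> p"

definition branch :: "'a \<Rightarrow> 'a" where
  "branch \<delta> = code (\<lambda>n. Some (b \<delta> n))"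

definition tree_dist :: "real \<Rightarrow> 'a \<Rightarrow> 'a \<Rightarrow> real" where
  "tree_dist t x y = baire_dist t (\<phi> x) (\<phi> y)"

lemma code:
  assumes "p \<in> tree b"
  shows "code p \<in> Field r" "\<phi> (code p) = p"
  using assms bij unfolding code_def bij_betw_def
  by (metis inv_into_into, metis f_inv_into_f)

lemma
  assumes "\<delta> \<in> Field r"
  shows branch_in_Field: "branch \<delta> \<in> Field r" and decode_branch: "\<phi> (branch \<delta>) n = Some (b \<delta> n)"
  using assms by (simp_all add: branch_def code tree_def)

lemma
  assumes "l \<in> lists (Field r)"
  shows list_code_in_Field: "code (list_seq l) \<in> Field r"
    and decode_list: "\<phi> (code (list_seq l)) = list_seq l"
  using assms by (simp_all add: code tree_def)

lemma ultrametric_on_tree_dist: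
  assumes "0 < t" "t < 1"
  shows "ultrametric_on (Field r) (tree_dist t)"
  unfolding tree_dist_def using bij
  by (intro ultrametric_on_pullback[OF ultrametric_on_baire_dist[OF assms]] bij_betw_imp_inj_on) auto

definition tree_hull :: "'a \<Rightarrow> 'a set" where
  "tree_hull x = {y \<in> Field r. \<exists>n. \<phi> x n = Some y} \<union> code ` list_seq ` lists (under x)"

lemma tree_hull_subset_Field: "tree_hull x \<subseteq> Field r"
proof -
  have "lists (under x) \<subseteq> lists (Field r)" by (rule lists_mono[OF under_Field])
  then show ?thesis using list_code_in_Field unfolding tree_hull_def by blast
qed

lemma small_tree_hull:
  assumes "x \<in> Field r"
  shows "small (tree_hull x)"
proof -
  have "{y \<in> Field r. \<exists>n. \<phi> x n = Some y} \<subseteq> range (\<lambda>n. the (\<phi> x n))"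
    by (auto simp: image_iff) (metis option.sel)
  then have "countable {y \<in> Field r. \<exists>n. \<phi> x n = Some y}" by (rule countable_subset) simp
  then show ?thesis
    unfolding tree_hull_def using assms
    by (intro small_Un small_countable small_image small_lists small_under)
qed

definition closed_branch :: "('a \<Rightarrow> 'a set) \<Rightarrow> 'a \<Rightarrow> bool" where
  "closed_branch S \<delta> \<longleftrightarrow> \<delta> \<in> Field r \<and>
     (\<forall>n. b \<delta> n \<sqsubset> b \<delta> (Suc n) \<and> b \<delta> n \<in> closure_points (\<lambda>x. tree_hull x \<union> S x))"

lemma ex_closed_branch:
  assumes "\<And>x. x \<in> Field r \<Longrightarrow> S x \<subseteq> Field r" "\<And>x. x \<in> Field r \<Longrightarrow> small (S x)"
  shows "\<exists>\<delta>. closed_branch S \<delta>"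
proof -
  have "club (closure_points (\<lambda>x. tree_hull x \<union> S x))"
  proof (rule club_closure_points)
    fix x assume x: "x \<in> Field r"
    show "tree_hull x \<union> S x \<subseteq> Field r"
      using tree_hull_subset_Field assms(1)[OF x] by (rule Un_least)
    show "small (tree_hull x \<union> S x)"
      using small_tree_hull[OF x] assms(2)[OF x] by (rule small_Un)
  qed
  then obtain \<delta> where "\<delta> \<in> Field r"
    "\<forall>n. b \<delta> n \<in> closure_points (\<lambda>x. tree_hull x \<union> S x) \<and> b \<delta> n \<sqsubset> b \<delta> (Suc n)"
    using guesses_clubs[unfolded guesses_clubs_def] by blast
  then have "closed_branch S \<delta>" by (simp add: closed_branch_def)
  then show ?thesis ..
qed

context
  fixes S :: "'a \<Rightarrow> 'a set" and \<delta> :: 'a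
  assumes closed: "closed_branch S \<delta>"
begin

lemma closed_branch_Field: "\<delta> \<in> Field r"
  using closed by (simp add: closed_branch_def)

lemma closed_branch_increasing: "b \<delta> n \<sqsubset> b \<delta> (Suc n)"
  using closed by (simp add: closed_branch_def)

lemma closed_branch_below:
  assumes "x \<sqsubset> b \<delta> n" "y \<in> tree_hull x \<union> S x"
  shows "y \<sqsubset> b \<delta> n"
proof (rule closure_pointsD)
  show "b \<delta> n \<in> closure_points (\<lambda>x. tree_hull x \<union> S x)"
    using closed by (simp add: closed_branch_def)
qed (use assms in blast)+

lemma tree_dist_branch_ge:
  assumes t: "0 < t" "t < 1" and x: "x \<sqsubset> b \<delta> n"
  shows "t ^ n \<le> tree_dist t x (branch \<delta>)"
proof -
  have "b \<delta> n \<notin> tree_hull x" using closed_branch_below[OF x, of "b \<delta> n"] by blast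
  moreover have "b \<delta> n \<in> Field r" using x by (auto simp: Field_def)
  ultimately have "\<phi> x n \<noteq> \<phi> (branch \<delta>) n"
    using decode_branch[OF closed_branch_Field] by (auto simp: tree_hull_def)
  then show ?thesis unfolding tree_dist_def by (rule baire_dist_ge[OF t])
qed

lemma tree_dist_prefix_branch:
  "\<exists>x. x \<sqsubset> b \<delta> (Suc n) \<and> tree_dist t x (branch \<delta>) = t ^ Suc n"
proof -
  define l where "l = map (b \<delta>) [0..<Suc n]"
  have "b \<delta> k \<in> under (b \<delta> n)" if "k \<le> n" for k
  proof (cases "k = n")
    case True
    have "b \<delta> n \<in> Field r" using closed_branch_increasing[of n] by (auto simp: Field_def)
    then show ?thesis using REFL True by (simp add: Refl_under_in)
  next
    case False
    then show ?thesis
      using strictly_below_sequence[of "b \<delta>" k n, OF closed_branch_increasing] that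
      by (simp add: under_def)
  qed
  then have l: "l \<in> lists (under (b \<delta> n))" by (simp add: l_def lists_eq_set image_subset_iff)
  then have "code (list_seq l) \<in> tree_hull (b \<delta> n) \<union> S (b \<delta> n)" by (simp add: tree_hull_def)
  with closed_branch_increasing have "code (list_seq l) \<sqsubset> b \<delta> (Suc n)"
    by (rule closed_branch_below)
  moreover have "l \<in> lists (Field r)" using lists_mono[OF under_Field] l by (rule subsetD)
  then have "\<phi> (code (list_seq l)) = list_seq l" by (rule decode_list)
  then have "tree_dist t (code (list_seq l)) (branch \<delta>) = t ^ Suc n"
    unfolding tree_dist_def
    by (intro baire_dist_eq)
      (auto simp: decode_branch[OF closed_branch_Field] list_seq_def l_def nth_append simp del: upt_Suc)
  ultimately show ?thesis by blast
qed

end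

context
  fixes t K :: real and e :: "'a \<Rightarrow> 'a \<Rightarrow> real" and f :: "'a \<Rightarrow> 'a"
  assumes t: "0 < t" "t < 1" and e: "metric_on (Field r) e"
    and K: "1 \<le> K" and f: "f ` Field r \<subseteq> Field r"
    and bilip: "\<And>x y. x \<in> Field r \<Longrightarrow> y \<in> Field r \<Longrightarrow>
      tree_dist t x y / K \<le> e (f x) (f y) \<and> e (f x) (f y) \<le> K * tree_dist t x y"
begin

definition approximant :: "'a \<Rightarrow> nat \<Rightarrow> 'a" where
  "approximant z n = (SOME x. x \<in> Field r \<and> e z (f x) < t ^ n / (2 * K))"

text \<open>Intersecting with the field discards approximants that do not exist, whose value is arbitrary.\<close>

definition image_hull :: "'a \<Rightarrow> 'a set" where
  "image_hull x = insert (f x) (Field r \<inter> range (approximant x))"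

lemma ex_image_hull_closed_branch: "\<exists>\<delta>. closed_branch image_hull \<delta>"
proof (rule ex_closed_branch)
  fix x assume "x \<in> Field r"
  then show "image_hull x \<subseteq> Field r" using f by (auto simp: image_hull_def)
  show "small (image_hull x)" by (intro small_countable) (simp add: image_hull_def)
qed

lemma prefix_image_close_to_branch_image:
  assumes closed: "closed_branch image_hull \<delta>" and "n > 0"
  shows "\<exists>z\<in>underS (b \<delta> n). e z (f (branch \<delta>)) \<le> 2 * K * t ^ n"
proof -
  obtain x where x: "x \<sqsubset> b \<delta> n" "tree_dist t x (branch \<delta>) = t ^ n"
    using tree_dist_prefix_branch[OF closed, of "n - 1" t] assms(2) by auto
  have "x \<in> Field r" using x(1) by (auto simp: Field_def)
  then have "e (f x) (f (branch \<delta>)) \<le> K * t ^ n"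
    using bilip[OF _ branch_in_Field[OF closed_branch_Field[OF closed]]] x(2) by metis
  also have "\<dots> \<le> 2 * K * t ^ n" using K t by simp
  finally have "e (f x) (f (branch \<delta>)) \<le> 2 * K * t ^ n" .
  moreover have "f x \<sqsubset> b \<delta> n"
    by (rule closed_branch_below[OF closed x(1)]) (simp add: image_hull_def)
  ultimately show ?thesis by (auto simp: underS_def)
qed

lemma branch_image_far_from_below:
  assumes closed: "closed_branch image_hull \<delta>" and z: "z \<sqsubset> b \<delta> n"
  shows "t ^ n \<le> 2 * K * e z (f (branch \<delta>))"
proof -
  note branch = branch_in_Field[OF closed_branch_Field[OF closed]]
  have "z \<in> Field r" "f (branch \<delta>) \<in> Field r" using z branch f by (auto intro: FieldI1)
  with e have "t ^ n / (2 * K) \<le> e z (f (branch \<delta>))"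
  proof (rule metric_on_ge_if_approximable)
    assume "e z (f (branch \<delta>)) < t ^ n / (2 * K)"
    with branch have "\<exists>x. x \<in> Field r \<and> e z (f x) < t ^ n / (2 * K)" by blast
    then have x: "approximant z n \<in> Field r" "e z (f (approximant z n)) < t ^ n / (2 * K)"
      using someI_ex[of "\<lambda>x. x \<in> Field r \<and> e z (f x) < t ^ n / (2 * K)"]
      by (simp_all add: approximant_def)
    then have "approximant z n \<sqsubset> b \<delta> n"
      by (intro closed_branch_below[OF closed z]) (simp add: image_hull_def)
    then have "t ^ n / K \<le> tree_dist t (approximant z n) (branch \<delta>) / K"
      using tree_dist_branch_ge[OF closed t] K by (intro divide_right_mono) simp_all
    also have "\<dots> \<le> e (f (approximant z n)) (f (branch \<delta>))" using bilip[OF x(1) branch] ..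
    finally have "2 * (t ^ n / (2 * K)) \<le> e (f (approximant z n)) (f (branch \<delta>))" by simp
    moreover have "f (approximant z n) \<in> Field r" using x(1) f by blast
    ultimately show "\<exists>w\<in>Field r. e z w < t ^ n / (2 * K) \<and>
        2 * (t ^ n / (2 * K)) \<le> e w (f (branch \<delta>))"
      using x(2) by blast
  qed
  then show ?thesis using K by (simp add: field_simps)
qed

lemma bilip_image_approached:
  "\<exists>\<delta>\<in>Field r. \<exists>y\<in>Field r. approaches_geometrically e (\<lambda>n. underS (b \<delta> n)) y t"
proof -
  obtain \<delta> where closed: "closed_branch image_hull \<delta>" using ex_image_hull_closed_branch ..
  have "approaches_geometrically e (\<lambda>n. underS (b \<delta> n)) (f (branch \<delta>)) t"
    unfolding approaches_geometrically_def
  proof (intro exI[of _ "2 * K"] conjI allI impI ballI)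
    show "0 < 2 * K" using K by simp
    fix n :: nat assume "n > 0"
    then show "\<exists>z\<in>underS (b \<delta> n). e z (f (branch \<delta>)) \<le> 2 * K * t ^ n"
      by (rule prefix_image_close_to_branch_image[OF closed])
    show "t ^ n \<le> 2 * K * e z (f (branch \<delta>))" if "z \<in> underS (b \<delta> n)" for z
      using that by (intro branch_image_far_from_below[OF closed]) (simp add: underS_def)
  qed
  then show ?thesis
    using closed_branch_Field[OF closed] branch_in_Field f by blast
qed

end

end

section \<open>Ultrametrics that do not embed\<close>

context uncountable_regular_cardinal
begin

lemma ex_ultrametric_not_bilip_embeds:
  fixes I :: "'i set" and D :: "'i \<Rightarrow> 'a \<Rightarrow> 'a \<Rightarrow> real"
  assumes w: "uncountable_regular_cardinal w" "w <o r"
    and r: "r <o |UNIV :: real set|" and I: "|I| <o |UNIV :: real set|"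
    and D: "\<And>i. i \<in> I \<Longrightarrow> metric_on (Field r) (D i)"
  shows "\<exists>d. ultrametric_on (Field r) d \<and> (\<forall>i\<in>I. \<not> bilip_embeds (Field r) d (Field r) (D i))"
proof -
  obtain b where b: "guesses_clubs b" using ex_guesses_clubs[OF w] by blast
  obtain \<phi> where \<phi>: "bij_betw \<phi> (Field r) (tree b)"
    using card_of_Field_ordIso[OF Card_order] card_of_tree[of b]
      card_of_ordIso[of "Field r" "tree b"] ordIso_symmetric ordIso_transitive by blast
  interpret coded_guessing_tree r b \<phi> using b \<phi> by unfold_locales
  have "|Field r| <o |UNIV :: real set|"
    using card_of_Field_ordIso[OF Card_order] r by (rule ordIso_ordLess_trans)
  then have "|I \<times> Field r \<times> Field r| <o |UNIV :: real set|"
    using I by (intro card_of_Times_ordLess_infinite infinite_UNIV_char_0)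
  from ex_ratio_not_approached[OF this, of "\<lambda>(i, \<delta>, y). D i" "\<lambda>(i, \<delta>, y) n. underS (b \<delta> n)"
      "\<lambda>(i, \<delta>, y). y"]
  obtain t where t: "0 < t" "t < 1" and far: "\<And>i \<delta> y. i \<in> I \<Longrightarrow> \<delta> \<in> Field r \<Longrightarrow> y \<in> Field r \<Longrightarrow>
      \<not> approaches_geometrically (D i) (\<lambda>n. underS (b \<delta> n)) y t"
    by fastforce
  have "\<not> bilip_embeds (Field r) (tree_dist t) (Field r) (D i)" if i: "i \<in> I" for i
  proof
    assume "bilip_embeds (Field r) (tree_dist t) (Field r) (D i)"
    then obtain K f where K: "K \<ge> 1" and f: "f ` Field r \<subseteq> Field r" and
      bilip: "\<forall>x\<in>Field r. \<forall>y\<in>Field r.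
        tree_dist t x y / K \<le> D i (f x) (f y) \<and> D i (f x) (f y) \<le> K * tree_dist t x y"
      unfolding bilip_embeds_def by (elim exE conjE) (rule that)
    show False
      using bilip_image_approached[OF t D[OF i] K f bspec[OF bspec[OF bilip]]] far[OF i] by blast
  qed
  then show ?thesis using ultrametric_on_tree_dist[OF t] by blast
qed

lemma ex_ultrametric_not_embeds_into:
  fixes e :: "'b \<Rightarrow> 'b \<Rightarrow> real"
  assumes w: "uncountable_regular_cardinal w" "w <o r" and r: "r <o |UNIV :: real set|"
    and M: "|M| =o r" and e: "metric_on M e"
  shows "\<exists>d. ultrametric_on (Field r) d \<and>
    \<not> bilip_embeds (Field r) d M e \<and> \<not> almost_isom_embeds (Field r) d M e"
proof -
  have "|Field r| =o |M|"
    using card_of_Field_ordIso[OF Card_order] M ordIso_symmetric ordIso_transitive by blast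
  then obtain g where g: "bij_betw g (Field r) M" using card_of_ordIso[of "Field r" M] by blast
  let ?e = "\<lambda>x y. e (g x) (g y)"
  have "metric_on (Field r) ?e"
    using g by (intro metric_on_pullback[OF e]) (auto simp: bij_betw_def)
  moreover have "|UNIV :: unit set| <o |UNIV :: real set|"
    using small_countable[OF countable_finite[OF finite_UNIV]] r by (rule ordLess_transitive)
  ultimately obtain d where d: "ultrametric_on (Field r) d" "\<not> bilip_embeds (Field r) d (Field r) ?e"
    using ex_ultrametric_not_bilip_embeds[OF w r, of "UNIV :: unit set" "\<lambda>_. ?e"] by blast
  have "\<not> bilip_embeds (Field r) d M e"
    using bilip_embeds_pullback[of "Field r" d M e g "Field r"] d(2) g by (auto simp: bij_betw_def)
  moreover from this have "\<not> almost_isom_embeds (Field r) d M e"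
    using bilip_embeds_if_almost_isom_embeds d(1) e unfolding ultrametric_on_def by blast
  ultimately show ?thesis using d(1) by blast
qed

end

theorem theorem6p2:
  fixes r :: "'a rel"
    and I :: "'i set"
    and D :: "'i \<Rightarrow> 'a \<Rightarrow> 'a \<Rightarrow> real"
  assumes "Card_order r"
    and "regularCard r"
    and "(cardSuc natLeq, r) \<in> ordLess"
    and "(r, card_of (UNIV :: real set)) \<in> ordLess"
    and "(card_of I, card_of (UNIV :: real set)) \<in> ordLess"
    and "\<forall>i\<in>I. metric_on (Field r) (D i)"
  shows "(\<exists>d. ultrametric_on (Field r) d \<and>
            (\<forall>i\<in>I. \<not> (\<exists>K::real. K \<ge> 1 \<and> (\<exists>f. inj_on f (Field r) \<and> f ` Field r \<subseteq> Field r \<and>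
               (\<forall>x\<in>Field r. \<forall>y\<in>Field r.
                  d x y / K \<le> D i (f x) (f y) \<and> D i (f x) (f y) \<le> K * d x y))))) \<and>
         (\<forall>(M :: 'b set) (e :: 'b \<Rightarrow> 'b \<Rightarrow> real).
            (card_of M, r) \<in> ordIso \<and> metric_on M e \<longrightarrow>
            (\<exists>d. ultrametric_on (Field r) d \<and> \<not> bilip_embeds (Field r) d M e) \<and>
            (\<exists>d. ultrametric_on (Field r) d \<and> \<not> almost_isom_embeds (Field r) d M e))"
proof -
  interpret uncountable_regular_cardinal r
    using assms(1,2) ordLess_transitive[OF cardSuc_greater[OF natLeq_Card_order] assms(3)]
    by unfold_locales
  have aleph1: "uncountable_regular_cardinal (cardSuc natLeq)"
    using natLeq_Cinfinite by (rule uncountable_regular_cardinal_cardSuc)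
  have "\<exists>d. ultrametric_on (Field r) d \<and> (\<forall>i\<in>I. \<not> bilip_embeds (Field r) d (Field r) (D i))"
    using assms(6) by (intro ex_ultrametric_not_bilip_embeds[OF aleph1 assms(3-5)]) blast
  moreover have "\<exists>d. ultrametric_on (Field r) d \<and> \<not> bilip_embeds (Field r) d M e"
    and "\<exists>d. ultrametric_on (Field r) d \<and> \<not> almost_isom_embeds (Field r) d M e"
    if "|M| =o r \<and> metric_on M e" for M :: "'b set" and e
    using ex_ultrametric_not_embeds_into[OF aleph1 assms(3,4), of M e] that by blast+
  ultimately show ?thesis
    unfolding bilip_embeds_def[of _ _ "Field r"] by (intro conjI allI impI)
qed

end
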